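(* Let $\mathbf R\subset\mathbb R^2$ be a region of area $1$ and let $O$ be a point in the interior of $\mathbf R$. Take $O$ as the origin of polar coordinates and assume that the boundary $\partial\mathbf R$ is the curve $\{(r(\theta),\theta):\theta\in[0,2\pi]\}$, where $r$ is a positive, continuous, piecewise differentiable function. Let $A,B,C$ be independent points, each uniformly distributed in $\mathbf R$, and let $\mathcal P$ be the probability that the triangle $\triangle ABC$ contains $O$. Let $f$ be the density on $\partial\mathbf R$ (with respect to arc length) defined by the condition that $\int_{\overset{\frown}{st}} f(x)\,dx=\frac12\int_{\theta_s}^{\theta_t} r(\theta)^2\,d\theta$ for all boundary points $s=(r(\theta_s),\theta_s)$, $t=(r(\theta_t),\theta_t)$ with $\theta_s\le\theta_t$ and $\theta_t-\theta_s\le 2\pi$. Here $\overset{\frown}{st}$ is the arc of $\partial\mathbf R$ from $s$ to $t$, traversed counterclockwise. In particular $\int_{\partial\mathbf R}f=1$. Define the involution $F:\partial\mathbf R\to\partial\mathbf R$ by $F((r(\theta),\theta))=(r(\theta+\pi),\theta+\pi)$. For $t\in\partial\mathbf R$, let $H(t)=\int_{\overset{\frown}{tF(t)}}f(x)\,dx$; this is the area of the part of $\mathbf R$ lying to the right of the line from $t$ to $F(t)$. For a point $\mathbf u\in\partial\mathbf R$, put $\mathbf v=F(\mathbf u)$ and $G(t)=\int_{\overset{\frown}{\mathbf u t}}f(x)\,dx$. Then the following hold. (i) For every $\mathbf u\in\partial\mathbf R$, $$\mathcal P=-G(\mathbf v)^2\,[3-2G(\mathbf v)]+6\int_{\overset{\frown}{\mathbf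 u\mathbf v}}H(t)\,[1-H(t)]\,f(t)\,dt .$$ (ii) For every $\mathbf u\in\partial\mathbf R$, with $x=G(\mathbf v)$, $$\mathcal P=\frac14-\frac{(1-2x)^3}{4}-6\int_{\overset{\frown}{\mathbf u\mathbf v}}\Big[\frac12-H(t)\Big]^2 f(t)\,dt .$$ (iii) There exists $\mathbf u\in\partial\mathbf R$ such that $$\mathcal P=\frac14-6\int_{\overset{\frown}{\mathbf u\mathbf v}}\Big[\frac12-H(t)\Big]^2 f(t)\,dt .$$ (iv) Independently of any choice of $\mathbf u$, $$\mathcal P=-\frac12+3\int_{\partial\mathbf R}H(t)\,[1-H(t)]\,f(t)\,dt=\frac14-3\int_{\partial\mathbf R}\Big[\frac12-H(t)\Big]^2 f(t)\,dt .$$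
   Context: All integrals of the form $\int \varphi(t)f(t)\,dt$ over an arc of $\partial\mathbf R$ are taken with respect to the measure $f(t)\,dt$. Equivalently, in the polar parametrization this measure is $\frac12 r(\theta)^2\,d\theta$. Arcs of $\partial\mathbf R$ are always traversed counterclockwise. *)

theory Defs
  imports "HOL-Analysis.Analysis"
begin

text \<open>Points of the plane are complex numbers; O is the origin 0.
  The region bounded by the polar curve rho = r theta (r 2pi-periodic).\<close>
definition polar_region :: "(real \<Rightarrow> real) \<Rightarrow> complex set" where
  "polar_region r = {complex_of_real \<rho> * cis \<theta> | \<rho> \<theta>. 0 \<le> \<rho> \<and> \<rho> \<le> r \<theta>}"

definition triangle_prob :: "complex set \<Rightarrow> real" where
  "triangle_prob R =
     measure lborel {(a :: complex, b :: complex, c :: complex).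
        a \<in> R \<and> b \<in> R \<and> c \<in> R \<and> 0 \<in> convex hull {a, b, c}} / (measure lborel R) ^ 3"

text \<open>Integral of phi against f over the counterclockwise arc from angle a to angle b,
  i.e. against (1/2) r(theta)^2 d theta.\<close>
definition arc_int :: "(real \<Rightarrow> real) \<Rightarrow> real \<Rightarrow> real \<Rightarrow> (real \<Rightarrow> real) \<Rightarrow> real" where
  "arc_int r a b \<phi> = integral {a..b} (\<lambda>\<theta>. \<phi> \<theta> * (r \<theta>)\<^sup>2 / 2)"

definition Hfun :: "(real \<Rightarrow> real) \<Rightarrow> real \<Rightarrow> real" where
  "Hfun r \<theta> = arc_int r \<theta> (\<theta> + pi) (\<lambda>_. 1)"

end

theory Submission
  imports Defs "HOL-Probability.Probability_Measure"
begin

text \<open>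
  Write \<open>[a, b]\<close> for the cross product and \<open>g = r\<^sup>2 / 2\<close>. For three points in general position, the
  signs of \<open>[a, b]\<close>, \<open>[b, c]\<close>, \<open>[c, a]\<close> either all agree, and then
  \<open>[b, c] a + [c, a] b + [a, b] c = 0\<close> puts the origin into the triangle, or exactly one vertex has
  both others on its left, and then the triangle misses the origin. In polar coordinates the points
  of the region to the left of a point of angle \<open>\<theta>\<close> have area \<open>H \<theta>\<close>, so the probability is
  \<open>1 - 3 \<integral> H\<^sup>2 g\<close>, taken over any full turn. Since \<open>H (\<theta> + \<pi>) = 1 - H \<theta>\<close> and
  \<open>H' \<theta> = g (\<theta> + \<pi>) - g \<theta>\<close>, an integral of \<open>\<phi> (H) g\<close> over a full turn is the integral of
  \<open>(\<phi> (H) + \<phi> (1 - H)) g + \<phi> (1 - H) H'\<close> over a half turn, where the last term is exact. The case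
  \<open>\<phi> x = x\<^sup>2\<close> evaluates the probability over a half turn, and \<open>\<phi> x = x\<close> gives \<open>\<integral> H g = 1 / 2\<close>,
  which removes the dependence on the starting point over a full turn. As \<open>H\<close> and \<open>1 - H\<close> are
  exchanged by a half turn, \<open>H\<close> takes the value \<open>1 / 2\<close>, where the boundary term vanishes.
\<close>

subsection \<open>Images of Lebesgue measure\<close>

lemma inner_linear_Basis_bij:
  fixes f :: "'a::euclidean_space \<Rightarrow> 'b::euclidean_space"
  assumes lin: "linear f" and bij: "bij_betw f Basis Basis" and b: "b \<in> Basis"
  shows "f x \<bullet> f b = x \<bullet> b"
proof -
  have f_Basis: "f i \<bullet> f b = (if i = b then 1 else 0)" if "i \<in> Basis" for i
  proof -
    have "f i \<in> Basis" "f b \<in> Basis" "f i = f b \<longleftrightarrow> i = b"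
      using that b bij by (auto simp: bij_betw_def inj_on_eq_iff)
    then show ?thesis by (simp add: inner_Basis)
  qed
  have "f x = f (\<Sum>i\<in>Basis. (x \<bullet> i) *\<^sub>R i)"
    by (simp add: euclidean_representation)
  also have "\<dots> = (\<Sum>i\<in>Basis. (x \<bullet> i) *\<^sub>R f i)"
    by (simp only: linear_sum[OF lin] linear_scale[OF lin])
  finally have "f x \<bullet> f b = (\<Sum>i\<in>Basis. (x \<bullet> i) * (f i \<bullet> f b))"
    by (simp add: inner_sum_left)
  also have "\<dots> = (\<Sum>i\<in>Basis. if i = b then x \<bullet> i else 0)"
    by (rule sum.cong) (simp_all add: f_Basis)
  also have "\<dots> = x \<bullet> b"
    using b by simp
  finally show ?thesis .
qed

lemma distr_lborel_Basis:
  fixes f :: "'a::euclidean_space \<Rightarrow> 'b::euclidean_space"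
  assumes lin: "linear f" and bij: "bij_betw f Basis Basis"
  shows "distr lborel borel f = lborel"
proof (rule lborel_eqI[symmetric])
  have [measurable]: "f \<in> borel_measurable borel"
    using lin by (intro borel_measurable_continuous_onI linear_continuous_on)
      (simp add: linear_conv_bounded_linear)
  fix l u :: 'b
  assume le: "\<And>b. b \<in> Basis \<Longrightarrow> l \<bullet> b \<le> u \<bullet> b"
  define pull :: "'b \<Rightarrow> 'a" where "pull y = (\<Sum>b\<in>Basis. (y \<bullet> f b) *\<^sub>R b)" for y
  have pull: "pull y \<bullet> b = y \<bullet> f b" if "b \<in> Basis" for y b
    using that by (simp add: pull_def)
  have Basis: "Basis = f ` Basis"
    using bij by (auto simp: bij_betw_def)
  have "f -` box l u = box (pull l) (pull u)"
    unfolding box_def Basis by (auto simp: inner_linear_Basis_bij[OF lin bij] pull)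
  moreover have "pull l \<bullet> b \<le> pull u \<bullet> b" if "b \<in> Basis" for b
    using that le Basis by (auto simp: pull)
  ultimately have "emeasure (distr lborel borel f) (box l u) = (\<Prod>b\<in>Basis. (pull u - pull l) \<bullet> b)"
    by (simp add: emeasure_distr)
  also have "(\<Prod>b\<in>Basis. (pull u - pull l) \<bullet> b) = (\<Prod>b\<in>Basis. (u - l) \<bullet> f b)"
    by (rule prod.cong) (auto simp: inner_diff_left pull)
  also have "\<dots> = (\<Prod>b\<in>Basis. (u - l) \<bullet> b)"
    by (rule prod.reindex_bij_betw[OF bij])
  finally show "emeasure (distr lborel borel f) (box l u) = (\<Prod>b\<in>Basis. (u - l) \<bullet> b)" .
qed simp

lemma has_derivative_image_in_sets_lebesgue:
  fixes g :: "'a::euclidean_space \<Rightarrow> 'b::euclidean_space"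
  assumes "S \<in> sets lebesgue" and "\<And>x. x \<in> S \<Longrightarrow> (g has_derivative g' x) (at x within S)"
    and "DIM('a) \<le> DIM('b)"
  shows "g ` S \<in> sets lebesgue"
  using assms by (intro differentiable_image_in_sets_lebesgue)
    (auto simp: differentiable_on_def differentiable_def)

lemma emeasure_differentiable_image:
  fixes g :: "real^'n::{finite,wellorder} \<Rightarrow> real^'n::_"
  assumes S: "S \<in> sets lebesgue"
    and der: "\<And>x. x \<in> S \<Longrightarrow> (g has_derivative g' x) (at x within S)"
    and inj: "inj_on g S"
  shows "emeasure lebesgue (g ` S) = (\<integral>\<^sup>+x. ennreal \<bar>det (matrix (g' x))\<bar> \<partial>lebesgue_on S)"
    (is "?L = ?R")
proof -
  let ?D = "\<lambda>x. \<bar>det (matrix (g' x))\<bar>"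
  have sets: "g ` S \<in> sets lebesgue"
    by (rule has_derivative_image_in_sets_lebesgue[OF S der]) simp_all
  have meas: "(\<lambda>x. ?D x * indicator S x) \<in> borel_measurable lebesgue"
  proof -
    have "?D \<in> borel_measurable (lebesgue_on S)"
      by (intro borel_measurable_abs borel_measurable_det_Jacobian[OF S der])
    then show ?thesis
      using S by (simp add: borel_measurable_restrict_space_iff mult.commute)
  qed
  have eq_ennreal_iff: "?L = ennreal m \<longleftrightarrow> ?R = ennreal m" if "0 \<le> m" for m
  proof -
    have "?L = ennreal m \<longleftrightarrow> g ` S \<in> lmeasurable \<and> measure lebesgue (g ` S) = m"
      using that sets by (cases ?L) (auto simp: measure_def fmeasurable_def)
    also have "\<dots> \<longleftrightarrow> (?D has_integral m) S"
      by (rule has_measure_differentiable_image[OF S der inj])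
    also have "\<dots> \<longleftrightarrow> ((\<lambda>x. ?D x * indicator S x) has_integral m) UNIV"
      by (subst has_integral_restrict_UNIV[symmetric])
        (simp add: indicator_def of_bool_def if_distrib cong: if_cong)
    also have "\<dots> \<longleftrightarrow> ?R = ennreal m"
      using that S meas
      by (subst has_integral_iff_nn_integral_lebesgue)
        (auto simp: nn_integral_restrict_space ennreal_mult'' ennreal_indicator)
    finally show ?thesis .
  qed
  show ?thesis
  proof (cases "?L = top \<and> ?R = top")
    case False
    then obtain m where "0 \<le> m" "?L = ennreal m \<or> ?R = ennreal m"
      by (metis ennreal_cases)
    with eq_ennreal_iff show ?thesis by auto
  qed simp
qed

lemma nn_integral_differentiable_image:
  fixes g :: "real^'n::{finite,wellorder} \<Rightarrow> real^'n::_"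
  assumes S: "S \<in> sets lebesgue"
    and der: "\<And>x. x \<in> S \<Longrightarrow> (g has_derivative g' x) (at x within S)"
    and inj: "inj_on g S" and f: "f \<in> borel_measurable borel"
  shows "(\<integral>\<^sup>+y. f y \<partial>lebesgue_on (g ` S))
       = (\<integral>\<^sup>+x. ennreal \<bar>det (matrix (g' x))\<bar> * f (g x) \<partial>lebesgue_on S)"
proof -
  let ?D = "\<lambda>x. ennreal \<bar>det (matrix (g' x))\<bar>"
  have D: "?D \<in> borel_measurable (lebesgue_on S)"
    using borel_measurable_det_Jacobian[OF S der] by simp
  have g: "g \<in> lebesgue_on S \<rightarrow>\<^sub>M borel"
    using S der by (intro continuous_imp_measurable_on_sets_lebesgue has_derivative_continuous_on)
  have image: "g ` S \<in> sets lebesgue"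
    by (rule has_derivative_image_in_sets_lebesgue[OF S der]) simp_all
  have id: "(\<lambda>y. y) \<in> lebesgue_on (g ` S) \<rightarrow>\<^sub>M borel"
    by (intro measurable_restrict_space1 measurable_completion) simp
  have "distr (lebesgue_on (g ` S)) borel (\<lambda>y. y) = distr (density (lebesgue_on S) ?D) borel g"
  proof (rule measure_eqI)
    fix A assume "A \<in> sets (distr (lebesgue_on (g ` S)) borel (\<lambda>y. y))"
    then have A: "A \<in> sets borel" by simp
    let ?S = "S \<inter> g -` A"
    have preimage: "?S \<in> sets lebesgue"
      using measurable_sets[OF g A] S by (simp add: sets_restrict_space_iff Int_commute)
    have "emeasure (distr (lebesgue_on (g ` S)) borel (\<lambda>y. y)) A = emeasure lebesgue (g ` ?S)"
      using A image id by (auto simp: emeasure_distr emeasure_restrict_space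
          intro!: arg_cong[where f = "emeasure lebesgue"])
    also have "\<dots> = (\<integral>\<^sup>+x. ?D x \<partial>lebesgue_on ?S)"
      by (intro emeasure_differentiable_image preimage inj_on_subset[OF inj] has_derivative_subset[OF der]) auto
    also have "\<dots> = (\<integral>\<^sup>+x. ?D x * indicator (g -` A \<inter> S) x \<partial>lebesgue_on S)"
      using S preimage by (auto simp: nn_integral_restrict_space indicator_def intro!: nn_integral_cong)
    also have "\<dots> = emeasure (distr (density (lebesgue_on S) ?D) borel g) A"
      using g A D measurable_sets[OF g A] by (simp add: emeasure_distr emeasure_density)
    finally show "emeasure (distr (lebesgue_on (g ` S)) borel (\<lambda>y. y)) A
      = emeasure (distr (density (lebesgue_on S) ?D) borel g) A" .
  qed simp
  then have "(\<integral>\<^sup>+y. f y \<partial>distr (lebesgue_on (g ` S)) borel (\<lambda>y. y))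
      = (\<integral>\<^sup>+y. f y \<partial>distr (density (lebesgue_on S) ?D) borel g)"
    by simp
  then show ?thesis
    using f g D id by (simp add: nn_integral_distr nn_integral_density measurable_compose[OF g f])
qed

subsection \<open>Polar coordinates\<close>

lemma vector2_conv_axis:
  "(\<lambda>(x, y). vector [x, y] :: real^2) = (\<lambda>p. fst p *\<^sub>R axis 1 1 + snd p *\<^sub>R axis 2 1)"
  by (auto simp: fun_eq_iff vec_eq_iff forall_2 axis_def)

lemma distr_lborel_vector2:
  "distr lborel borel (\<lambda>(x, y). vector [x, y] :: real^2) = lborel"
proof (rule distr_lborel_Basis)
  show "linear (\<lambda>(x, y). vector [x, y] :: real^2)"
    unfolding vector2_conv_axis by (auto intro!: linearI simp: algebra_simps)
  show "bij_betw (\<lambda>(x, y). vector [x, y] :: real^2) Basis Basis"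
    unfolding vector2_conv_axis
    by (auto simp: bij_betw_def inj_on_def Basis_prod_def Basis_vec_def UNIV_2 axis_eq_axis)
qed

lemma distr_lborel_Complex:
  "distr lborel borel (\<lambda>v::real^2. Complex (v $ 1) (v $ 2)) = lborel"
proof (rule distr_lborel_Basis)
  show "linear (\<lambda>v::real^2. Complex (v $ 1) (v $ 2))"
    by (auto intro!: linearI simp: complex_eq_iff)
  show "bij_betw (\<lambda>v::real^2. Complex (v $ 1) (v $ 2)) Basis Basis"
    by (auto simp: bij_betw_def inj_on_def Basis_vec_def Basis_complex_def UNIV_2 axis_def
        complex_eq_iff)
qed

lemma borel_measurable_rcis [measurable (raw)]:
  assumes "f \<in> borel_measurable M" "g \<in> borel_measurable M"
  shows "(\<lambda>x. rcis (f x) (g x)) \<in> borel_measurable M"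
  by (rule borel_measurable_continuous_Pair[OF assms]) (intro continuous_intros)

lemma borel_measurable_vec_nth [measurable (raw)]:
  fixes f :: "'a \<Rightarrow> real^'n"
  assumes "f \<in> borel_measurable M"
  shows "(\<lambda>x. f x $ i) \<in> borel_measurable M"
  using assms by (rule borel_measurable_continuous_on[rotated]) (intro continuous_intros)

lemma bij_betw_rcis:
  "bij_betw (\<lambda>(\<rho>, \<theta>). rcis \<rho> \<theta>) ({0<..} \<times> {c<..c + 2 * pi}) (- {0})"
proof (rule bij_betwI)
  let ?a = "c + pi"
  let ?polar = "\<lambda>z. (cmod z, ?a + Arg (z / cis ?a))"
  have "c < ?a + Arg w \<and> ?a + Arg w \<le> c + 2 * pi" for w
    using Arg_bounded[of w] by simp
  then show "?polar \<in> - {0} \<rightarrow> {0<..} \<times> {c<..c + 2 * pi}"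
    by auto
  show "?polar (case p of (\<rho>, \<theta>) \<Rightarrow> rcis \<rho> \<theta>) = p"
    if window: "p \<in> {0<..} \<times> {c<..c + 2 * pi}" for p
  proof -
    obtain \<rho> \<theta> where p: "p = (\<rho>, \<theta>)" "0 < \<rho>" "c < \<theta>" "\<theta> \<le> c + 2 * pi"
      using window by auto
    have "rcis \<rho> \<theta> / cis ?a = rcis \<rho> (\<theta> - ?a)"
      by (simp add: cis_rcis_eq rcis_divide)
    with p show ?thesis by (simp add: Arg_rcis)
  qed
  show "(case ?polar z of (\<rho>, \<theta>) \<Rightarrow> rcis \<rho> \<theta>) = z" for z
  proof -
    have "rcis (cmod z) (?a + Arg (z / cis ?a)) = cis ?a * rcis (cmod (z / cis ?a)) (Arg (z / cis ?a))"
      by (simp add: cis_rcis_eq rcis_mult norm_divide)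
    then show ?thesis by (simp add: rcis_cmod_Arg)
  qed
qed auto

definition polar_vec2 :: "real^2 \<Rightarrow> real^2" where
  "polar_vec2 p = vector [p $ 1 * cos (p $ 2), p $ 1 * sin (p $ 2)]"

lemma Complex_polar_vec2: "Complex (polar_vec2 p $ 1) (polar_vec2 p $ 2) = rcis (p $ 1) (p $ 2)"
  by (simp add: polar_vec2_def complex_eq_iff)

lemma has_derivative_polar_vec2:
  "(polar_vec2 has_derivative
    (\<lambda>h. vector [h $ 1 * cos (p $ 2) - p $ 1 * (sin (p $ 2) * h $ 2),
                 h $ 1 * sin (p $ 2) + p $ 1 * (cos (p $ 2) * h $ 2)])) (at p within S)"
proof -
  have "((\<lambda>p::real^2. p $ i) has_derivative (\<lambda>h. h $ i)) (at p within S)" for i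
    by (simp add: bounded_linear_imp_has_derivative bounded_linear_vec_nth)
  then show ?thesis
    unfolding polar_vec2_def
    by (subst has_derivative_componentwise_within)
       (auto simp: Basis_vec_def UNIV_2 inner_axis intro!: derivative_eq_intros)
qed

lemma det_polar_vec2_derivative:
  "det (matrix (\<lambda>h::real^2. vector [h $ 1 * cos t - \<rho> * (sin t * h $ 2),
                                     h $ 1 * sin t + \<rho> * (cos t * h $ 2)] :: real^2)) = \<rho>"
proof -
  have "\<rho> * (cos t * cos t) + \<rho> * (sin t * sin t) = \<rho>"
    by (simp add: sin_cos_squared_add3 flip: distrib_left)
  then show ?thesis
    by (simp add: det_2 matrix_def axis_def mult_ac)
qed

definition polar_strip :: "real \<Rightarrow> (real^2) set" where
  "polar_strip c = {p. 0 < p $ 1 \<and> c < p $ 2 \<and> p $ 2 \<le> c + 2 * pi}"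

lemma borel_polar_strip [measurable]: "polar_strip c \<in> sets borel"
  unfolding polar_strip_def by measurable

lemma bij_betw_polar_vec2:
  "bij_betw polar_vec2 (polar_strip c) (- {0})"
proof -
  let ?pair = "\<lambda>p::real^2. (p $ 1, p $ 2)" and ?vec = "\<lambda>z. vector [Re z, Im z] :: real^2"
  have pair: "bij_betw ?pair (polar_strip c) ({0<..} \<times> {c<..c + 2 * pi})"
    by (rule bij_betwI[where g = "\<lambda>(\<rho>, \<theta>). vector [\<rho>, \<theta>]"]) (auto simp: polar_strip_def vec_eq_iff forall_2)
  have vec: "bij_betw ?vec (- {0}) (- {0})"
    by (rule bij_betwI[where g = "\<lambda>v. Complex (v $ 1) (v $ 2)"])
       (auto simp: vec_eq_iff forall_2 complex_eq_iff)
  have "polar_vec2 = ?vec \<circ> ((\<lambda>(\<rho>, \<theta>). rcis \<rho> \<theta>) \<circ> ?pair)"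
    by (simp add: fun_eq_iff polar_vec2_def)
  then show ?thesis
    using bij_betw_trans[OF bij_betw_trans[OF pair bij_betw_rcis] vec] by simp
qed

lemma nn_integral_polar_vec2:
  assumes [measurable]: "f \<in> borel_measurable borel"
  shows "(\<integral>\<^sup>+v. f v \<partial>lborel) = (\<integral>\<^sup>+p\<in>polar_strip c. ennreal (p $ 1) * f (polar_vec2 p) \<partial>lborel)"
proof -
  have inj: "inj_on polar_vec2 (polar_strip c)" and image: "polar_vec2 ` polar_strip c = - {0}"
    using bij_betw_polar_vec2[of c] by (auto simp: bij_betw_def)
  have "AE v in lebesgue. v \<noteq> (0 :: real^2)"
    by (intro AE_completion AE_lborel_singleton)
  then have "(\<integral>\<^sup>+v. f v \<partial>lebesgue) = (\<integral>\<^sup>+v. f v \<partial>lebesgue_on (polar_vec2 ` polar_strip c))"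
    by (auto simp: image nn_integral_restrict_space intro!: nn_integral_cong_AE elim: eventually_mono)
  also have "\<dots> = (\<integral>\<^sup>+p. ennreal \<bar>p $ 1\<bar> * f (polar_vec2 p) \<partial>lebesgue_on (polar_strip c))"
    using inj by (subst nn_integral_differentiable_image[OF _ has_derivative_polar_vec2])
      (auto simp: det_polar_vec2_derivative)
  also have "\<dots> = (\<integral>\<^sup>+p\<in>polar_strip c. ennreal (p $ 1) * f (polar_vec2 p) \<partial>lebesgue)"
    by (subst nn_integral_restrict_space)
       (auto simp: polar_strip_def indicator_def intro!: nn_integral_cong)
  finally show ?thesis
    by (simp add: nn_integral_completion)
qed

lemma nn_integral_polar:
  assumes [measurable]: "f \<in> borel_measurable borel"
  shows "(\<integral>\<^sup>+z. f z \<partial>lborel)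
    = (\<integral>\<^sup>+\<theta>\<in>{c<..c + 2 * pi}. (\<integral>\<^sup>+\<rho>\<in>{0<..}. ennreal \<rho> * f (rcis \<rho> \<theta>) \<partial>lborel) \<partial>lborel)"
proof -
  let ?F = "\<lambda>v::real^2. f (Complex (v $ 1) (v $ 2))"
  let ?P = "\<lambda>p. ennreal (p $ 1) * f (rcis (p $ 1) (p $ 2)) * indicator (polar_strip c) p"
  have [measurable]: "(\<lambda>v::real^2. Complex (v $ 1) (v $ 2)) \<in> borel_measurable borel"
    by (simp add: borel_measurable_complex_iff)
  have [measurable]: "(\<lambda>(x, y). vector [x, y] :: real^2) \<in> borel_measurable borel"
    unfolding vector2_conv_axis by (intro borel_measurable_continuous_onI continuous_intros)
  have indicator_polar_strip: "indicator (polar_strip c) (vector [\<rho>, \<theta>] :: real^2)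
      = (indicator {0<..} \<rho> * indicator {c<..c + 2 * pi} \<theta> :: ennreal)" for \<rho> \<theta>
    by (simp add: polar_strip_def indicator_def)
  have "(\<integral>\<^sup>+z. f z \<partial>lborel) = (\<integral>\<^sup>+v. ?F v \<partial>lborel)"
    by (subst distr_lborel_Complex[symmetric]) (simp add: nn_integral_distr)
  also have "\<dots> = (\<integral>\<^sup>+p. ?P p \<partial>lborel)"
    by (subst nn_integral_polar_vec2[where c = c]) (simp_all add: Complex_polar_vec2)
  also have "\<dots> = (\<integral>\<^sup>+q. ?P (case q of (x, y) \<Rightarrow> vector [x, y]) \<partial>(lborel \<Otimes>\<^sub>M lborel))"
    by (subst distr_lborel_vector2[symmetric]) (simp add: nn_integral_distr lborel_prod)
  also have "\<dots> = (\<integral>\<^sup>+\<theta>. \<integral>\<^sup>+\<rho>. ?P (vector [\<rho>, \<theta>]) \<partial>lborel \<partial>lborel)"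
    by (subst lborel_pair.nn_integral_snd[symmetric]) (auto simp: lborel_prod)
  also have "\<dots> = (\<integral>\<^sup>+\<theta>\<in>{c<..c + 2 * pi}. (\<integral>\<^sup>+\<rho>\<in>{0<..}. ennreal \<rho> * f (rcis \<rho> \<theta>) \<partial>lborel) \<partial>lborel)"
    by (simp add: indicator_polar_strip nn_integral_multc flip: mult.assoc)
  finally show ?thesis .
qed

lemma nn_integral_radial:
  assumes "0 \<le> R"
  shows "(\<integral>\<^sup>+\<rho>\<in>{0<..R}. ennreal \<rho> \<partial>lborel) = ennreal (R\<^sup>2 / 2)"
proof -
  have "(\<integral>\<^sup>+\<rho>\<in>{0<..R}. ennreal \<rho> \<partial>lborel) = (\<integral>\<^sup>+\<rho>\<in>{0..R}. ennreal \<rho> \<partial>lborel)"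
    by (intro nn_integral_cong) (auto simp: indicator_def)
  also have "\<dots> = ennreal (R\<^sup>2 / 2 - 0\<^sup>2 / 2)"
    by (rule nn_integral_FTC_Icc) (use assms in \<open>auto intro!: derivative_eq_intros\<close>)
  finally show ?thesis by simp
qed

subsection \<open>Triangles containing the origin\<close>

definition cross :: "complex \<Rightarrow> complex \<Rightarrow> real" where
  "cross a b = Re a * Im b - Im a * Re b"

lemma cross_commute: "cross b a = - cross a b"
  by (simp add: cross_def)

lemma cross_swap_pos_iff:
  assumes "cross a b \<noteq> 0"
  shows "cross b a > 0 \<longleftrightarrow> \<not> cross a b > 0"
  using assms cross_commute[of a b] by auto

lemma cross_rcis: "cross (rcis \<rho> \<alpha>) (rcis \<sigma> \<theta>) = \<rho> * \<sigma> * sin (\<theta> - \<alpha>)"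
  by (simp add: cross_def sin_diff algebra_simps)

lemma borel_measurable_cross [measurable (raw)]:
  assumes "f \<in> borel_measurable M" "g \<in> borel_measurable M"
  shows "(\<lambda>x. cross (f x) (g x)) \<in> borel_measurable M"
  unfolding cross_def
  by (rule borel_measurable_continuous_Pair[OF assms]) (intro continuous_intros)

lemma AE_cross_nonzero:
  assumes "a \<noteq> 0"
  shows "AE b in lborel. cross a b \<noteq> 0"
proof -
  have "negligible {b. Complex (- Im a) (Re a) \<bullet> b = 0}"
    by (rule negligible_hyperplane) (use assms in \<open>auto simp: complex_eq_iff\<close>)
  also have "{b. Complex (- Im a) (Re a) \<bullet> b = 0} = {b. cross a b = 0}"
    by (auto simp: cross_def inner_complex_def)
  finally have "{b. cross a b = 0} \<in> null_sets lebesgue"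
    by (simp add: negligible_iff_null_sets)
  moreover have "{b. cross a b = 0} \<in> sets lborel" by simp
  ultimately have "{b. cross a b = 0} \<in> null_sets lborel"
    by (simp add: null_sets_def)
  then show ?thesis
    by (auto dest: AE_not_in)
qed

lemma cross_scaleR_sum_eq_0:
  "cross b c *\<^sub>R a + cross c a *\<^sub>R b + cross a b *\<^sub>R c = 0"
  by (simp add: complex_eq_iff cross_def algebra_simps)

lemma zero_in_hull_if_cross_pos:
  assumes "cross a b > 0" "cross b c > 0" "cross c a > 0"
  shows "0 \<in> convex hull {a, b, c}"
proof -
  define s where "s = cross b c + cross c a + cross a b"
  have "(cross b c / s) *\<^sub>R a + (cross c a / s) *\<^sub>R b + (cross a b / s) *\<^sub>R c
     = (1 / s) *\<^sub>R (cross b c *\<^sub>R a + cross c a *\<^sub>R b + cross a b *\<^sub>R c)"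
    by (simp add: scaleR_add_right)
  then have "0 = (cross b c / s) *\<^sub>R a + (cross c a / s) *\<^sub>R b + (cross a b / s) *\<^sub>R c"
    by (simp add: cross_scaleR_sum_eq_0)
  moreover have "s > 0" "cross b c / s + cross c a / s + cross a b / s = 1"
    using assms by (simp_all add: s_def flip: add_divide_distrib)
  ultimately show ?thesis
    unfolding convex_hull_3 using assms
    by (intro CollectI exI[of _ "cross b c / s"] exI[of _ "cross c a / s"] exI[of _ "cross a b / s"]) auto
qed

definition both_left :: "complex \<Rightarrow> complex \<Rightarrow> complex \<Rightarrow> bool" where
  "both_left a b c \<longleftrightarrow> cross a b > 0 \<and> cross a c > 0"

lemma pred_both_left [measurable (raw)]:
  assumes [measurable]: "f \<in> borel_measurable M" "g \<in> borel_measurable M" "h \<in> borel_measurable M"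
  shows "Measurable.pred M (\<lambda>x. both_left (f x) (g x) (h x))"
  unfolding both_left_def by measurable

lemma zero_notin_hull_if_both_left:
  assumes "both_left a b c"
  shows "0 \<notin> convex hull {a, b, c}"
proof
  assume "0 \<in> convex hull {a, b, c}"
  then obtain u v w where comb: "0 = u *\<^sub>R a + v *\<^sub>R b + w *\<^sub>R c"
    and weights: "0 \<le> u" "0 \<le> v" "0 \<le> w" "u + v + w = 1"
    unfolding convex_hull_3 by auto
  have "0 = cross a (u *\<^sub>R a + v *\<^sub>R b + w *\<^sub>R c)"
    by (simp add: cross_def flip: comb)
  also have "\<dots> = v * cross a b + w * cross a c"
    by (simp add: cross_def algebra_simps)
  finally have "v * cross a b = 0 \<and> w * cross a c = 0"
    using assms weights by (simp add: both_left_def add_nonneg_eq_0_iff)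
  with assms weights comb have "a = 0" by (simp add: both_left_def)
  with assms show False by (simp add: both_left_def cross_def)
qed

lemma zero_in_hull_iff_cross_signs:
  assumes "cross a b \<noteq> 0" "cross b c \<noteq> 0" "cross c a \<noteq> 0"
  shows "0 \<in> convex hull {a, b, c}
    \<longleftrightarrow> (cross a b > 0 \<longleftrightarrow> cross b c > 0) \<and> (cross b c > 0 \<longleftrightarrow> cross c a > 0)"
proof -
  have rotate: "{b, c, a} = {a, b, c}" "{c, a, b} = {a, b, c}" "{a, c, b} = {a, b, c}" by auto
  note swap = assms[THEN cross_swap_pos_iff]
  note inside = zero_in_hull_if_cross_pos[of a b c] zero_in_hull_if_cross_pos[of a c b]
  note outside = zero_notin_hull_if_both_left[of a b c] zero_notin_hull_if_both_left[of b c a]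
    zero_notin_hull_if_both_left[of c a b]
  show ?thesis
    using inside outside unfolding both_left_def rotate swap by argo
qed

lemma zero_in_hull_both_left_partition:
  assumes "cross a b \<noteq> 0" "cross b c \<noteq> 0" "cross c a \<noteq> 0"
  shows "of_bool (0 \<in> convex hull {a, b, c})
     + of_bool (both_left a b c) + of_bool (both_left b c a) + of_bool (both_left c a b)
     = (1 :: 'a::semiring_1)"
  unfolding both_left_def zero_in_hull_iff_cross_signs[OF assms] assms[THEN cross_swap_pos_iff]
  by (cases "cross a b > 0"; cases "cross b c > 0"; cases "cross c a > 0") simp_all

lemma closed_mem_hull_3:
  fixes z :: "'a::euclidean_space"
  shows "closed {(a, b, c). z \<in> convex hull {a, b, c}}"
proof -
  let ?S = "{p :: real \<times> real. 0 \<le> fst p \<and> 0 \<le> snd p \<and> fst p + snd p \<le> 1}"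
  let ?T = "{((s, t), a, b, c). z = a + s *\<^sub>R (b - a) + t *\<^sub>R (c - a)}"
  have "closed ?S"
    by (intro closed_Collect_conj closed_Collect_le continuous_intros)
  moreover have "?S \<subseteq> cbox (0, 0) (1, 1)"
    by (auto simp: mem_box Basis_prod_def)
  ultimately have "compact ?S"
    by (meson bounded_cbox bounded_subset compact_eq_bounded_closed)
  moreover have "closed ?T"
    unfolding case_prod_beta by (intro closed_Collect_eq continuous_intros)
  ultimately have "closed {y. \<exists>x. x \<in> ?S \<and> (x, y) \<in> ?T}"
    by (rule closed_compact_projection)
  also have "{y. \<exists>x. x \<in> ?S \<and> (x, y) \<in> ?T} = {(a, b, c). z \<in> convex hull {a, b, c}}"
    by (auto simp: convex_hull_3_alt)
  finally show ?thesis .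
qed

lemma measurable_mem_hull_3 [measurable]:
  fixes z :: "'a::euclidean_space"
  shows "{(a, b, c). z \<in> convex hull {a, b, c}} \<in> sets (borel \<Otimes>\<^sub>M (borel \<Otimes>\<^sub>M borel))"
  unfolding borel_prod by (rule borel_closed[OF closed_mem_hull_3])

lemma nn_integral_rotate:
  fixes f :: "'a \<Rightarrow> 'b \<Rightarrow> 'c \<Rightarrow> ennreal"
  assumes "sigma_finite_measure M1" "sigma_finite_measure M2" "sigma_finite_measure M3"
    and f: "(\<lambda>(x, y, z). f x y z) \<in> borel_measurable (M1 \<Otimes>\<^sub>M (M2 \<Otimes>\<^sub>M M3))"
  shows "(\<integral>\<^sup>+z. \<integral>\<^sup>+x. \<integral>\<^sup>+y. f x y z \<partial>M2 \<partial>M1 \<partial>M3) = (\<integral>\<^sup>+x. \<integral>\<^sup>+y. \<integral>\<^sup>+z. f x y z \<partial>M3 \<partial>M2 \<partial>M1)"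
proof -
  interpret M1: sigma_finite_measure M1 by fact
  interpret M2: sigma_finite_measure M2 by fact
  interpret M3: sigma_finite_measure M3 by fact
  interpret M13: pair_sigma_finite M1 M3 ..
  interpret M23: pair_sigma_finite M2 M3 ..
  have [measurable (raw)]: "(\<lambda>p. f (u p) (v p) (w p)) \<in> borel_measurable N"
    if "u \<in> N \<rightarrow>\<^sub>M M1" "v \<in> N \<rightarrow>\<^sub>M M2" "w \<in> N \<rightarrow>\<^sub>M M3" for u v w and N :: "'d measure"
    using measurable_compose[OF measurable_Pair[OF that(1) measurable_Pair[OF that(2,3)]] f] by simp
  have "(\<integral>\<^sup>+z. \<integral>\<^sup>+x. \<integral>\<^sup>+y. f x y z \<partial>M2 \<partial>M1 \<partial>M3) = (\<integral>\<^sup>+x. \<integral>\<^sup>+z. \<integral>\<^sup>+y. f x y z \<partial>M2 \<partial>M3 \<partial>M1)"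
    by (rule M13.Fubini') measurable
  also have "\<dots> = (\<integral>\<^sup>+x. \<integral>\<^sup>+y. \<integral>\<^sup>+z. f x y z \<partial>M3 \<partial>M2 \<partial>M1)"
    by (intro nn_integral_cong M23.Fubini') measurable
  finally show ?thesis .
qed

lemma nn_integral_both_left:
  assumes sets_M [measurable_cong]: "sets M = sets borel"
  shows "(\<integral>\<^sup>+b. \<integral>\<^sup>+c. of_bool (both_left a b c) \<partial>M \<partial>M) = (emeasure M {b. cross a b > 0})\<^sup>2"
proof -
  have [measurable]: "{b. cross a b > 0} \<in> sets M"
    unfolding sets_M by measurable
  have "of_bool (both_left a b c)
      = (indicator {b. cross a b > 0} b * indicator {b. cross a b > 0} c :: ennreal)" for b c
    by (simp add: both_left_def indicator_def)
  then show ?thesis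
    by (simp add: nn_integral_cmult nn_integral_multc power2_eq_square)
qed

lemma AE_pairwise_cross_nonzero:
  assumes general_position: "AE a in M. AE b in M. cross a b \<noteq> 0"
  shows "AE a in M. AE b in M. AE c in M. cross a b \<noteq> 0 \<and> cross b c \<noteq> 0 \<and> cross c a \<noteq> 0"
  using general_position
proof eventually_elim
  case a: (elim a)
  then show ?case
    using general_position
  proof eventually_elim
    case b: (elim b)
    from a b(2) show ?case
    proof eventually_elim
      case (elim c)
      with b(1) show ?case by (simp add: cross_commute[of c a])
    qed
  qed
qed

lemma emeasure_zero_in_hull:
  fixes M :: "complex measure"
  assumes "prob_space M" and sets_M [measurable_cong]: "sets M = sets borel"
    and general_position: "AE a in M. AE b in M. cross a b \<noteq> 0"
  shows "emeasure (M \<Otimes>\<^sub>M (M \<Otimes>\<^sub>M M)) {(a, b, c). 0 \<in> convex hull {a, b, c}}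
     + 3 * (\<integral>\<^sup>+a. (emeasure M {b. cross a b > 0})\<^sup>2 \<partial>M) = 1" (is "emeasure _ ?Q + 3 * ?J = 1")
proof -
  interpret prob_space M by fact
  interpret MM: pair_sigma_finite M M ..
  interpret MM: sigma_finite_measure "M \<Otimes>\<^sub>M M" ..
  let ?int3 = "\<lambda>F :: complex \<Rightarrow> complex \<Rightarrow> complex \<Rightarrow> ennreal. \<integral>\<^sup>+a. \<integral>\<^sup>+b. \<integral>\<^sup>+c. F a b c \<partial>M \<partial>M \<partial>M"
  have rotate: "?int3 (\<lambda>a b c. F b c a) = ?int3 F"
    if "(\<lambda>(a, b, c). F a b c) \<in> borel_measurable (M \<Otimes>\<^sub>M (M \<Otimes>\<^sub>M M))" for F
    using that by (intro nn_integral_rotate sigma_finite_measure_axioms)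
  have left_a: "?int3 (\<lambda>a b c. of_bool (both_left a b c)) = ?J"
    by (simp add: nn_integral_both_left sets_M)
  have left_b: "?int3 (\<lambda>a b c. of_bool (both_left b c a)) = ?J"
    using rotate[of "\<lambda>a b c. of_bool (both_left a b c)"] left_a by simp
  have left_c: "?int3 (\<lambda>a b c. of_bool (both_left c a b)) = ?J"
    using rotate[of "\<lambda>a b c. of_bool (both_left b c a)"] left_b by simp
  have hull: "?int3 (\<lambda>a b c. indicator ?Q (a, b, c)) = emeasure (M \<Otimes>\<^sub>M (M \<Otimes>\<^sub>M M)) ?Q"
    by (simp add: MM.emeasure_pair_measure flip: nn_integral_fst)
  have total: "(\<integral>\<^sup>+x. f x \<partial>M) = 1" if "AE x in M. f x = 1" for f :: "complex \<Rightarrow> ennreal"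
    using nn_integral_cong_AE[OF that] by (simp add: emeasure_space_1)
  have "AE a in M. AE b in M. AE c in M. indicator ?Q (a, b, c) + of_bool (both_left a b c)
      + of_bool (both_left b c a) + of_bool (both_left c a b) = (1 :: ennreal)"
    using AE_pairwise_cross_nonzero[OF general_position]
    by (elim eventually_mono) (simp add: indicator_def zero_in_hull_both_left_partition)
  then have "1 = ?int3 (\<lambda>a b c. indicator ?Q (a, b, c) + of_bool (both_left a b c)
      + of_bool (both_left b c a) + of_bool (both_left c a b))"
    by (auto intro!: total[symmetric] total elim!: eventually_mono)
  also have "\<dots> = emeasure (M \<Otimes>\<^sub>M (M \<Otimes>\<^sub>M M)) ?Q + ?J + ?J + ?J"
    by (simp add: nn_integral_add hull left_a left_b left_c)
  also have "\<dots> = emeasure (M \<Otimes>\<^sub>M (M \<Otimes>\<^sub>M M)) ?Q + 3 * ?J"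
    using distrib_right[of 1 2 ?J] by (simp add: add.assoc mult_2)
  finally show ?thesis ..
qed

lemma pair_uniform_measure:
  assumes "sigma_finite_measure N"
    and A: "emeasure M A \<noteq> 0" "emeasure M A \<noteq> \<infinity>" and B: "emeasure N B \<noteq> 0" "emeasure N B \<noteq> \<infinity>"
  shows "uniform_measure M A \<Otimes>\<^sub>M uniform_measure N B = uniform_measure (M \<Otimes>\<^sub>M N) (A \<times> B)"
proof -
  interpret N: sigma_finite_measure N by fact
  interpret B: prob_space "uniform_measure N B" by (rule prob_space_uniform_measure[OF B])
  have [measurable]: "A \<in> sets M" "B \<in> sets N"
    using A(1) B(1) by (auto intro: emeasure_neq_0_sets)
  have "uniform_measure M A \<Otimes>\<^sub>M uniform_measure N B
     = density (M \<Otimes>\<^sub>M N) (\<lambda>(x, y). (indicator A x / emeasure M A) * (indicator B y / emeasure N B))"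
    using B.sigma_finite_measure_axioms unfolding uniform_measure_def
    by (intro pair_measure_density N.sigma_finite_measure_axioms) simp_all
  also have "(\<lambda>(x, y). (indicator A x / emeasure M A) * (indicator B y / emeasure N B))
     = (\<lambda>p. indicator (A \<times> B) p / emeasure (M \<Otimes>\<^sub>M N) (A \<times> B))"
    using A B by (auto simp: fun_eq_iff indicator_def N.emeasure_pair_measure_Times
        divide_ennreal_def ennreal_inverse_mult less_top)
  finally show ?thesis
    by (simp add: uniform_measure_def)
qed

lemma triangle_prob_eq_uniform_measure:
  assumes R: "emeasure lborel R \<noteq> 0" "emeasure lborel R \<noteq> \<infinity>"
  defines "U \<equiv> uniform_measure lborel R"
  shows "triangle_prob R = measure (U \<Otimes>\<^sub>M (U \<Otimes>\<^sub>M U)) {(a, b, c). 0 \<in> convex hull {a, b, c}}"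
proof -
  let ?Q = "{(a :: complex, b :: complex, c :: complex). 0 \<in> convex hull {a, b, c}}"
  have sets_R: "R \<in> sets lborel"
    using R(1) by (rule emeasure_neq_0_sets)
  note emeasure_Times = lborel.emeasure_pair_measure_Times[where N = lborel, unfolded lborel_prod]
  have RR: "emeasure lborel (R \<times> R) = emeasure lborel R ^ 2"
    and RRR: "emeasure lborel (R \<times> R \<times> R) = emeasure lborel R ^ 3"
    using sets_R by (simp_all add: emeasure_Times borel_Times power2_eq_square power3_eq_cube mult.assoc)
  have "U \<Otimes>\<^sub>M U = uniform_measure lborel (R \<times> R)"
    unfolding U_def by (subst pair_uniform_measure) (use R in \<open>auto simp: sigma_finite_lborel lborel_prod\<close>)
  then have "U \<Otimes>\<^sub>M (U \<Otimes>\<^sub>M U) = uniform_measure lborel (R \<times> R \<times> R)"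
    unfolding U_def using R RR
    by (simp, subst pair_uniform_measure) (auto simp: sigma_finite_lborel lborel_prod power_eq_top_ennreal)
  moreover have "?Q \<in> sets lborel"
    by (simp add: borel_closed closed_mem_hull_3)
  ultimately have "measure (U \<Otimes>\<^sub>M (U \<Otimes>\<^sub>M U)) ?Q
      = measure lborel (R \<times> R \<times> R \<inter> ?Q) / measure lborel (R \<times> R \<times> R)"
    using R RRR by (simp add: power_eq_top_ennreal)
  moreover have "R \<times> R \<times> R \<inter> ?Q = {(a, b, c). a \<in> R \<and> b \<in> R \<and> c \<in> R \<and> 0 \<in> convex hull {a, b, c}}"
    by auto
  ultimately show ?thesis
    using RRR by (simp add: triangle_prob_def measure_def power3_eq_cube enn2real_mult)
qed

subsection \<open>Densities of unit mass over a period\<close>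

lemma integral_fold_half:
  fixes F :: "real \<Rightarrow> real"
  assumes "continuous_on UNIV F" "0 \<le> p"
  shows "integral {u..u + 2 * p} F = integral {u..u + p} (\<lambda>t. F t + F (t + p))"
proof -
  have F: "F integrable_on {a..b}" for a b
    by (intro integrable_continuous_real continuous_on_subset[OF assms(1)]) simp
  have F_shift: "(\<lambda>t. F (t + p)) integrable_on {a..b}" for a b
    by (intro integrable_continuous_real continuous_on_compose2[OF assms(1)] continuous_intros) simp
  have "integral {u..u + 2 * p} F = integral {u..u + p} F + integral {u + p..u + p + p} F"
    using Henstock_Kurzweil_Integration.integral_combine[OF _ _ F, of u "u + p" "u + 2 * p"] assms(2)
    by (simp add: algebra_simps)
  also have "integral {u + p..u + p + p} F = integral {u..u + p} (\<lambda>t. F (t + p))"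
    by (subst integral_shift_Icc_real[symmetric]) (simp add: o_def add.commute)
  also have "integral {u..u + p} F + \<dots> = integral {u..u + p} (\<lambda>t. F t + F (t + p))"
    by (rule integral_add[OF F F_shift, symmetric])
  finally show ?thesis .
qed

locale unit_period_density =
  fixes g :: "real \<Rightarrow> real" and p :: real
  assumes p_nonneg: "0 \<le> p"
    and continuous_density: "continuous_on UNIV g"
    and integral_period: "integral {t..t + 2 * p} g = 1"
begin

definition half_mass :: "real \<Rightarrow> real" where
  "half_mass t = integral {t..t + p} g"

lemma continuous_on_density: "continuous_on S g"
  using continuous_density by (rule continuous_on_subset) simp

lemma half_mass_shift: "half_mass (t + p) = 1 - half_mass t"
proof -
  have "integral {t..t + p} g + integral {t + p..t + 2 * p} g = integral {t..t + 2 * p} g"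
    using p_nonneg by (intro Henstock_Kurzweil_Integration.integral_combine)
      (auto intro: integrable_continuous_real continuous_on_density)
  then show ?thesis
    using integral_period[of t] by (simp add: half_mass_def algebra_simps)
qed

lemma has_real_derivative_half_mass: "(half_mass has_real_derivative g (t + p) - g t) (at t)"
proof -
  define G where "G s = integral {t - 1..s} g" for s
  have G: "(G has_real_derivative g s) (at s)" if "t - 1 < s" for s
  proof -
    have "(G has_real_derivative g s) (at s within {t - 1..s + 1})"
      unfolding G_def by (rule integral_has_real_derivative) (use that continuous_on_density in auto)
    then show ?thesis
      using that by (subst (asm) at_within_interior) auto
  qed
  have "G (s + p) - G s = half_mass s" if "t - 1 < s" for s
    using that p_nonneg
      Henstock_Kurzweil_Integration.integral_combine[of "t - 1" s "s + p" g]
    by (simp add: G_def half_mass_def integrable_continuous_real continuous_on_density)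
  then have "\<forall>\<^sub>F s in nhds t. G (s + p) - G s = half_mass s"
    using eventually_nhds_in_open[of "{t - 1<..}" t] by (auto elim: eventually_mono)
  moreover have "((\<lambda>s. G (s + p) - G s) has_real_derivative g (t + p) - g t) (at t)"
    using G[of t] G[of "t + p"] p_nonneg
    by (auto intro!: derivative_eq_intros simp: DERIV_shift)
  ultimately show ?thesis
    by (subst (asm) DERIV_cong_ev) auto
qed

lemma continuous_on_half_mass: "continuous_on S half_mass"
  using has_real_derivative_half_mass by (meson DERIV_isCont continuous_at_imp_continuous_on)

lemma ex_half_mass_eq_half: "\<exists>t. half_mass t = 1 / 2"
proof -
  have "\<exists>t. 0 \<le> t \<and> t \<le> p \<and> half_mass t = 1 / 2" if "half_mass 0 \<le> 1 / 2"
    using that half_mass_shift[of 0] p_nonneg by (intro IVT') (auto intro: continuous_on_half_mass)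
  moreover have "\<exists>t. 0 \<le> t \<and> t \<le> p \<and> half_mass t = 1 / 2" if "1 / 2 \<le> half_mass 0"
    using that half_mass_shift[of 0] p_nonneg by (intro IVT2') (auto intro: continuous_on_half_mass)
  ultimately show ?thesis by (meson linear)
qed

lemma integral_half_mass_deriv:
  assumes \<Phi>: "\<And>x. (\<Phi> has_real_derivative \<phi> x) (at x)"
  shows "integral {u..u + p} (\<lambda>t. \<phi> (1 - half_mass t) * (g (t + p) - g t))
    = \<Phi> (1 - half_mass u) - \<Phi> (half_mass u)"
proof -
  let ?\<psi> = "\<lambda>t. \<phi> (1 - half_mass t) * (g (t + p) - g t)"
  have "(?\<psi> has_integral - \<Phi> (1 - half_mass (u + p)) - - \<Phi> (1 - half_mass u)) {u..u + p}"
  proof (rule fundamental_theorem_of_calculus)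
    fix t
    have "((\<lambda>t. 1 - half_mass t) has_real_derivative - (g (t + p) - g t)) (at t within {u..u + p})"
      by (auto intro!: derivative_eq_intros DERIV_subset[OF has_real_derivative_half_mass])
    from DERIV_minus[OF DERIV_chain2[OF \<Phi> this]]
    have "((\<lambda>t. - \<Phi> (1 - half_mass t)) has_real_derivative ?\<psi> t) (at t within {u..u + p})"
      by (simp add: algebra_simps)
    then show "((\<lambda>t. - \<Phi> (1 - half_mass t)) has_vector_derivative ?\<psi> t) (at t within {u..u + p})"
      by (simp add: has_real_derivative_iff_has_vector_derivative)
  qed (simp add: p_nonneg)
  then show ?thesis
    by (simp add: half_mass_shift has_integral_iff)
qed

lemma integral_period_half_mass:
  assumes cont: "continuous_on UNIV \<phi>" and \<Phi>: "\<And>x. (\<Phi> has_real_derivative \<phi> x) (at x)"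
  shows "integral {u..u + 2 * p} (\<lambda>t. \<phi> (half_mass t) * g t)
    = integral {u..u + p} (\<lambda>t. (\<phi> (half_mass t) + \<phi> (1 - half_mass t)) * g t)
      + \<Phi> (1 - half_mass u) - \<Phi> (half_mass u)"
proof -
  have \<phi>: "continuous_on S (\<lambda>t. \<phi> (f t))" if "continuous_on S f" for S and f :: "real \<Rightarrow> real"
    using continuous_on_compose2[OF cont that] by simp
  have shift: "continuous_on S (\<lambda>t. g (t + p))" for S
    by (rule continuous_on_compose2[OF continuous_density]) (auto intro!: continuous_intros)
  note continuous = continuous_intros \<phi> shift continuous_on_half_mass continuous_on_density
  have "integral {u..u + 2 * p} (\<lambda>t. \<phi> (half_mass t) * g t)
      = integral {u..u + p} (\<lambda>t. \<phi> (half_mass t) * g t + \<phi> (1 - half_mass t) * g (t + p))"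
    using integral_fold_half[of "\<lambda>t. \<phi> (half_mass t) * g t" p u]
    by (simp add: half_mass_shift p_nonneg continuous)
  also have "\<dots> = integral {u..u + p} (\<lambda>t. (\<phi> (half_mass t) + \<phi> (1 - half_mass t)) * g t
      + \<phi> (1 - half_mass t) * (g (t + p) - g t))"
    by (simp add: algebra_simps)
  also have "\<dots> = integral {u..u + p} (\<lambda>t. (\<phi> (half_mass t) + \<phi> (1 - half_mass t)) * g t)
      + integral {u..u + p} (\<lambda>t. \<phi> (1 - half_mass t) * (g (t + p) - g t))"
    by (rule integral_add) (auto intro!: integrable_continuous_real continuous)
  finally show ?thesis
    by (simp add: integral_half_mass_deriv[OF \<Phi>])
qed

lemma integral_half_mass_square_period:
  "integral {u..u + 2 * p} (\<lambda>t. (half_mass t)\<^sup>2 * g t)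
    = 1 / 2 - integral {u..u + 2 * p} (\<lambda>t. half_mass t * (1 - half_mass t) * g t)"
proof -
  have "integral {u..u + 2 * p} (\<lambda>t. (half_mass t)\<^sup>2 * g t)
      = integral {u..u + 2 * p} (\<lambda>t. half_mass t * g t - half_mass t * (1 - half_mass t) * g t)"
    by (simp add: algebra_simps power2_eq_square)
  also have "\<dots> = integral {u..u + 2 * p} (\<lambda>t. half_mass t * g t)
      - integral {u..u + 2 * p} (\<lambda>t. half_mass t * (1 - half_mass t) * g t)"
    by (intro integral_diff integrable_continuous_real continuous_intros continuous_on_half_mass
        continuous_on_density)
  also have "integral {u..u + 2 * p} (\<lambda>t. half_mass t * g t)
      = half_mass u + (1 - half_mass u)\<^sup>2 / 2 - (half_mass u)\<^sup>2 / 2"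
  proof -
    have "((\<lambda>x. x\<^sup>2 / 2) has_real_derivative x) (at x)" for x :: real
      by (auto intro!: derivative_eq_intros)
    from integral_period_half_mass[OF _ this] show ?thesis
      by (simp flip: half_mass_def)
  qed
  finally show ?thesis
    by (simp add: field_simps power2_eq_square)
qed

lemma integral_half_mass_square_half_period:
  "3 * integral {u..u + 2 * p} (\<lambda>t. (half_mass t)\<^sup>2 * g t)
    = 1 + (half_mass u)\<^sup>2 * (3 - 2 * half_mass u)
      - 6 * integral {u..u + p} (\<lambda>t. half_mass t * (1 - half_mass t) * g t)"
proof -
  have "integral {u..u + 2 * p} (\<lambda>t. (half_mass t)\<^sup>2 * g t)
      = integral {u..u + p} (\<lambda>t. ((half_mass t)\<^sup>2 + (1 - half_mass t)\<^sup>2) * g t)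
        + (1 - half_mass u) ^ 3 / 3 - half_mass u ^ 3 / 3"
    by (rule integral_period_half_mass) (auto intro!: continuous_intros derivative_eq_intros)
  also have "integral {u..u + p} (\<lambda>t. ((half_mass t)\<^sup>2 + (1 - half_mass t)\<^sup>2) * g t)
      = integral {u..u + p} (\<lambda>t. g t - 2 * (half_mass t * (1 - half_mass t) * g t))"
    by (simp add: algebra_simps power2_eq_square)
  also have "\<dots> = half_mass u - 2 * integral {u..u + p} (\<lambda>t. half_mass t * (1 - half_mass t) * g t)"
    by (subst integral_diff)
       (auto intro!: integrable_continuous_real continuous_intros continuous_on_half_mass
         continuous_on_density simp flip: half_mass_def)
  finally show ?thesis
    by (simp add: field_simps power2_eq_square power3_eq_cube)
qed

lemma integral_half_mass_complement:
  "integral {a..b} (\<lambda>t. half_mass t * (1 - half_mass t) * g t)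
    = integral {a..b} g / 4 - integral {a..b} (\<lambda>t. (1 / 2 - half_mass t)\<^sup>2 * g t)"
proof -
  have "integral {a..b} (\<lambda>t. half_mass t * (1 - half_mass t) * g t)
      = integral {a..b} (\<lambda>t. g t / 4 - (1 / 2 - half_mass t)\<^sup>2 * g t)"
    by (intro integral_cong) (simp add: field_simps power2_eq_square)
  also have "\<dots> = integral {a..b} (\<lambda>t. g t / 4) - integral {a..b} (\<lambda>t. (1 / 2 - half_mass t)\<^sup>2 * g t)"
    by (intro integral_diff integrable_continuous_real continuous_intros continuous_on_half_mass
        continuous_on_density) simp
  finally show ?thesis by simp
qed

end

subsection \<open>Regions bounded by a polar curve\<close>

lemma nn_integral_Ioc_eq_integral:
  fixes F :: "real \<Rightarrow> real"
  assumes cont: "continuous_on {a..b} F" and nonneg: "\<And>x. x \<in> {a..b} \<Longrightarrow> 0 \<le> F x"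
  shows "(\<integral>\<^sup>+x\<in>{a<..b}. ennreal (F x) \<partial>lborel) = ennreal (integral {a..b} F)"
proof -
  have "(\<integral>\<^sup>+x\<in>{a<..b}. ennreal (F x) \<partial>lborel) = (\<integral>\<^sup>+x\<in>{a..b}. ennreal (F x) \<partial>lborel)"
    using AE_lborel_singleton[of a]
    by (intro nn_integral_cong_AE, eventually_elim) (auto simp: indicator_def)
  also have "\<dots> = ennreal (integral {a..b} F)"
    using nonneg integrable_continuous_real[OF cont]
    by (intro nn_integral_has_integral_lebesgue' integrable_integral)
  finally show ?thesis .
qed

locale polar_curve =
  fixes r :: "real \<Rightarrow> real"
  assumes pos: "r \<theta> > 0"
    and cont: "continuous_on UNIV r"
    and periodic: "r (\<theta> + 2 * pi) = r \<theta>"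
begin

definition sector_density :: "real \<Rightarrow> real" where
  "sector_density \<theta> = (r \<theta>)\<^sup>2 / 2"

lemma sector_density_nonneg: "0 \<le> sector_density \<theta>"
  by (simp add: sector_density_def)

lemma continuous_on_sector_density: "continuous_on S sector_density"
  unfolding sector_density_def by (intro continuous_intros continuous_on_subset[OF cont]) simp_all

lemma radius_eq_if_cis_eq:
  assumes "cis \<theta> = cis \<theta>'"
  shows "r \<theta> = r \<theta>'"
proof -
  interpret periodic_fun_simple r "2 * pi"
    by standard (rule periodic)
  have "sin \<theta> = sin \<theta>' \<and> cos \<theta> = cos \<theta>'"
    using assms by (simp add: complex_eq_iff)
  then obtain n :: int where "\<theta> = \<theta>' + 2 * pi * of_int n"
    unfolding sin_cos_eq_iff by blast
  then show ?thesis
    using plus_of_int[of \<theta>' n] by (simp add: mult_ac)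
qed

lemma rcis_mem_polar_region_iff:
  assumes "0 \<le> \<rho>"
  shows "rcis \<rho> \<theta> \<in> polar_region r \<longleftrightarrow> \<rho> \<le> r \<theta>"
proof
  assume "rcis \<rho> \<theta> \<in> polar_region r"
  then obtain \<rho>' \<theta>' where eq: "rcis \<rho> \<theta> = rcis \<rho>' \<theta>'" and \<rho>': "0 \<le> \<rho>'" "\<rho>' \<le> r \<theta>'"
    unfolding polar_region_def rcis_def by blast
  have "\<rho> = \<rho>'"
    using arg_cong[OF eq, of cmod] assms \<rho>' by simp
  show "\<rho> \<le> r \<theta>"
  proof (cases "\<rho> = 0")
    case False
    with eq \<open>\<rho> = \<rho>'\<close> have "cis \<theta> = cis \<theta>'"
      by (simp add: rcis_def)
    then have "r \<theta> = r \<theta>'"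
      by (rule radius_eq_if_cis_eq)
    with \<rho>' \<open>\<rho> = \<rho>'\<close> show ?thesis by simp
  qed (simp add: less_imp_le[OF pos])
next
  assume "\<rho> \<le> r \<theta>"
  with assms show "rcis \<rho> \<theta> \<in> polar_region r"
    unfolding polar_region_def rcis_def by blast
qed

lemma compact_polar_region: "compact (polar_region r)"
proof -
  let ?K = "{0..1} \<times> {- pi..pi} :: (real \<times> real) set"
  let ?F = "\<lambda>p. rcis (fst p * r (snd p)) (snd p)"
  have "polar_region r = ?F ` ?K"
  proof (intro equalityI subsetI)
    fix z assume z: "z \<in> polar_region r"
    define t where "t = Arg z"
    have z_eq: "z = rcis (cmod z) t"
      by (simp add: t_def rcis_cmod_Arg)
    with z have "cmod z \<le> r t"
      using rcis_mem_polar_region_iff[of "cmod z" t] by simp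
    moreover have "- pi \<le> t" "t \<le> pi"
      using Arg_bounded[of z] by (auto simp: t_def)
    ultimately show "z \<in> ?F ` ?K"
      using z_eq pos[of t] by (intro image_eqI[of _ _ "(cmod z / r t, t)"]) auto
  next
    fix z assume "z \<in> ?F ` ?K"
    then obtain s t where z: "z = rcis (s * r t) t" and s: "0 \<le> s" "s \<le> 1" by auto
    have "s * r t \<le> r t" "0 \<le> s * r t"
      using s pos[of t] by (auto intro: mult_left_le_one_le)
    with z show "z \<in> polar_region r"
      by (simp add: rcis_mem_polar_region_iff)
  qed
  moreover have "continuous_on ?K ?F"
    by (intro continuous_intros continuous_on_compose2[OF cont]) auto
  ultimately show ?thesis
    by (simp add: compact_continuous_image compact_Times)
qed

lemma borel_polar_region [measurable]: "polar_region r \<in> sets borel"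
  using compact_polar_region by (simp add: borel_closed compact_imp_closed)

lemma nn_integral_polar_region:
  assumes [measurable]: "f \<in> borel_measurable borel"
    and angular: "\<And>\<rho> \<theta>. 0 < \<rho> \<Longrightarrow> f (rcis \<rho> \<theta>) = \<phi> \<theta>"
  shows "(\<integral>\<^sup>+z\<in>polar_region r. f z \<partial>lborel)
    = (\<integral>\<^sup>+\<theta>\<in>{c<..c + 2 * pi}. \<phi> \<theta> * ennreal (sector_density \<theta>) \<partial>lborel)"
proof -
  have "(\<integral>\<^sup>+\<rho>\<in>{0<..}. ennreal \<rho> * (f (rcis \<rho> \<theta>) * indicator (polar_region r) (rcis \<rho> \<theta>)) \<partial>lborel)
      = \<phi> \<theta> * ennreal (sector_density \<theta>)" for \<theta>
  proof -
    have "(\<integral>\<^sup>+\<rho>\<in>{0<..}. ennreal \<rho> * (f (rcis \<rho> \<theta>) * indicator (polar_region r) (rcis \<rho> \<theta>)) \<partial>lborel)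
        = (\<integral>\<^sup>+\<rho>. \<phi> \<theta> * (ennreal \<rho> * indicator {0<..r \<theta>} \<rho>) \<partial>lborel)"
      by (intro nn_integral_cong)
         (auto simp: indicator_def angular rcis_mem_polar_region_iff mult.commute[of "\<phi> \<theta>"])
    then show ?thesis
      by (simp add: nn_integral_cmult nn_integral_radial sector_density_def less_imp_le[OF pos])
  qed
  then show ?thesis
    by (subst nn_integral_polar[where c = c]) simp_all
qed

end

locale unit_polar_curve = polar_curve +
  assumes area: "measure lborel (polar_region r) = 1"
begin

lemma emeasure_polar_region: "emeasure lborel (polar_region r) = 1"
  using area emeasure_compact_finite[OF compact_polar_region]
  by (simp add: emeasure_eq_ennreal_measure top.not_eq_extremum)

sublocale unit_period_density sector_density pi
proof
  fix t
  have "1 = (\<integral>\<^sup>+z\<in>polar_region r. 1 \<partial>lborel)"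
    by (simp add: emeasure_polar_region)
  also have "\<dots> = (\<integral>\<^sup>+\<theta>\<in>{t<..t + 2 * pi}. ennreal (sector_density \<theta>) \<partial>lborel)"
    by (subst nn_integral_polar_region[where c = t and \<phi> = "\<lambda>_. 1"]) auto
  also have "\<dots> = ennreal (integral {t..t + 2 * pi} sector_density)"
    by (intro nn_integral_Ioc_eq_integral continuous_on_sector_density sector_density_nonneg)
  finally show "integral {t..t + 2 * pi} sector_density = 1"
    by (metis ennreal_eq_1)
qed (simp_all add: continuous_on_sector_density)

lemma arc_int_eq: "arc_int r a b \<phi> = integral {a..b} (\<lambda>t. \<phi> t * sector_density t)"
  by (simp add: arc_int_def sector_density_def)

lemma Hfun_eq_half_mass: "Hfun r = half_mass"
  by (simp add: fun_eq_iff Hfun_def half_mass_def arc_int_eq)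

definition uniform :: "complex measure" where
  "uniform = uniform_measure lborel (polar_region r)"

lemma sets_uniform [simp, measurable_cong]: "sets uniform = sets borel"
  by (simp add: uniform_def)

lemma prob_space_uniform: "prob_space uniform"
  unfolding uniform_def by (rule prob_space_uniform_measure) (simp_all add: emeasure_polar_region)

lemma nn_integral_uniform:
  assumes "f \<in> borel_measurable borel" and "\<And>\<rho> \<theta>. 0 < \<rho> \<Longrightarrow> f (rcis \<rho> \<theta>) = \<phi> \<theta>"
  shows "(\<integral>\<^sup>+z. f z \<partial>uniform) = (\<integral>\<^sup>+\<theta>\<in>{c<..c + 2 * pi}. \<phi> \<theta> * ennreal (sector_density \<theta>) \<partial>lborel)"
  using nn_integral_polar_region[OF assms]
  by (simp add: uniform_def nn_integral_uniform_measure assms(1) emeasure_polar_region divide_ennreal_def)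

lemma AE_uniform:
  assumes "AE z in lborel. P z"
  shows "AE z in uniform. P z"
  unfolding uniform_def by (rule AE_uniform_measureI) (use assms in auto)

lemma emeasure_uniform_left:
  assumes "0 < \<rho>"
  shows "emeasure uniform {b. cross (rcis \<rho> \<alpha>) b > 0} = ennreal (half_mass \<alpha>)"
proof -
  let ?L = "{b. cross (rcis \<rho> \<alpha>) b > 0}"
  have left_iff: "cross (rcis \<rho> \<alpha>) (rcis \<sigma> \<theta>) > 0 \<longleftrightarrow> sin (\<theta> - \<alpha>) > 0" if "0 < \<sigma>" for \<sigma> \<theta>
    using mult_less_cancel_left_pos[OF mult_pos_pos[OF assms that], of 0] by (simp add: cross_rcis)
  have [measurable]: "?L \<in> sets borel" by measurable
  have "emeasure uniform ?L = (\<integral>\<^sup>+b. indicator ?L b \<partial>uniform)"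
    by simp
  also have "\<dots> = (\<integral>\<^sup>+\<theta>\<in>{\<alpha><..\<alpha> + 2 * pi}. indicator {\<theta>. sin (\<theta> - \<alpha>) > 0} \<theta>
      * ennreal (sector_density \<theta>) \<partial>lborel)"
    by (intro nn_integral_uniform) (simp_all add: indicator_def left_iff)
  also have "\<dots> = (\<integral>\<^sup>+\<theta>\<in>{\<alpha><..\<alpha> + pi}. ennreal (sector_density \<theta>) \<partial>lborel)"
    using AE_lborel_singleton[of "\<alpha> + pi"]
  proof (intro nn_integral_cong_AE, eventually_elim)
    case (elim \<theta>)
    have "sin (\<theta> - \<alpha>) > 0 \<longleftrightarrow> \<theta> \<le> \<alpha> + pi" if "\<alpha> < \<theta>" "\<theta> \<le> \<alpha> + 2 * pi"
      using sin_gt_zero[of "\<theta> - \<alpha>"] sin_le_zero[of "\<theta> - \<alpha>"] sin_2pi_minus elim that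
      by (cases "\<theta> \<le> \<alpha> + pi"; cases "\<theta> = \<alpha> + 2 * pi") auto
    then show ?case using pi_gt_zero by (auto simp: indicator_def)
  qed
  also have "\<dots> = ennreal (half_mass \<alpha>)"
    unfolding half_mass_def
    by (intro nn_integral_Ioc_eq_integral continuous_on_sector_density sector_density_nonneg)
  finally show ?thesis .
qed

lemma nn_integral_uniform_left_square:
  "(\<integral>\<^sup>+a. (emeasure uniform {b. cross a b > 0})\<^sup>2 \<partial>uniform)
    = ennreal (integral {c..c + 2 * pi} (\<lambda>t. (half_mass t)\<^sup>2 * sector_density t))"
proof -
  interpret U: prob_space uniform by (rule prob_space_uniform)
  have nonneg: "0 \<le> half_mass t" for t
    unfolding half_mass_def
    by (intro integral_nonneg integrable_continuous_real continuous_on_sector_density sector_density_nonneg)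
  have "emeasure uniform {b. cross a b > 0} = (\<integral>\<^sup>+b. of_bool (cross a b > 0) \<partial>uniform)" for a
  proof -
    have "emeasure uniform {b. cross a b > 0} = (\<integral>\<^sup>+b. indicator {b. cross a b > 0} b \<partial>uniform)"
      by simp
    then show ?thesis by (simp add: indicator_def)
  qed
  then have "(\<lambda>a. emeasure uniform {b. cross a b > 0}) \<in> borel_measurable borel"
    by simp
  then have "(\<integral>\<^sup>+a. (emeasure uniform {b. cross a b > 0})\<^sup>2 \<partial>uniform)
      = (\<integral>\<^sup>+\<theta>\<in>{c<..c + 2 * pi}. (ennreal (half_mass \<theta>))\<^sup>2 * ennreal (sector_density \<theta>) \<partial>lborel)"
    by (intro nn_integral_uniform) (simp_all add: emeasure_uniform_left)
  also have "\<dots> = (\<integral>\<^sup>+\<theta>\<in>{c<..c + 2 * pi}. ennreal ((half_mass \<theta>)\<^sup>2 * sector_density \<theta>) \<partial>lborel)"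
    by (simp add: ennreal_mult sector_density_nonneg ennreal_power nonneg)
  also have "\<dots> = ennreal (integral {c..c + 2 * pi} (\<lambda>t. (half_mass t)\<^sup>2 * sector_density t))"
    by (intro nn_integral_Ioc_eq_integral continuous_intros continuous_on_half_mass continuous_on_sector_density)
       (simp add: sector_density_nonneg)
  finally show ?thesis .
qed

lemma triangle_prob_eq_integral:
  "triangle_prob (polar_region r)
    = 1 - 3 * integral {c..c + 2 * pi} (\<lambda>t. (half_mass t)\<^sup>2 * sector_density t)"
proof -
  let ?K = "integral {c..c + 2 * pi} (\<lambda>t. (half_mass t)\<^sup>2 * sector_density t)"
  let ?U3 = "uniform \<Otimes>\<^sub>M (uniform \<Otimes>\<^sub>M uniform)"
    and ?Q = "{(a, b, c). 0 \<in> convex hull {a, b, c :: complex}}"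
  have "AE a in uniform. AE b in uniform. cross a b \<noteq> 0"
    using AE_uniform[OF AE_lborel_singleton] by eventually_elim (rule AE_uniform[OF AE_cross_nonzero])
  from emeasure_zero_in_hull[OF prob_space_uniform _ this]
  have eq: "emeasure ?U3 ?Q + 3 * ennreal ?K = 1"
    by (simp add: nn_integral_uniform_left_square[of c])
  moreover have "emeasure ?U3 ?Q = ennreal (triangle_prob (polar_region r))"
  proof -
    have "triangle_prob (polar_region r) = measure ?U3 ?Q"
      unfolding uniform_def by (rule triangle_prob_eq_uniform_measure) (simp_all add: emeasure_polar_region)
    moreover have "emeasure ?U3 ?Q \<noteq> top"
      using eq by auto
    ultimately show ?thesis
      by (simp add: emeasure_eq_ennreal_measure)
  qed
  moreover have "0 \<le> ?K"
    by (intro integral_nonneg integrable_continuous_real continuous_intros continuous_on_half_mass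
        continuous_on_sector_density) (simp add: sector_density_nonneg)
  moreover have "0 \<le> triangle_prob (polar_region r)"
    by (simp add: triangle_prob_def)
  ultimately have "ennreal (triangle_prob (polar_region r) + 3 * ?K) = 1"
    by (simp add: ennreal_mult)
  then show ?thesis
    by (simp only: ennreal_eq_1)
qed

lemma triangle_prob_half_turn:
  "triangle_prob (polar_region r) = - (half_mass u)\<^sup>2 * (3 - 2 * half_mass u)
    + 6 * integral {u..u + pi} (\<lambda>t. half_mass t * (1 - half_mass t) * sector_density t)"
  using triangle_prob_eq_integral[of u] integral_half_mass_square_half_period[of u] by simp

lemma triangle_prob_half_turn_square:
  "triangle_prob (polar_region r) = 1 / 4 - (1 - 2 * half_mass u) ^ 3 / 4
    - 6 * integral {u..u + pi} (\<lambda>t. (1 / 2 - half_mass t)\<^sup>2 * sector_density t)"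
proof -
  define V where "V = integral {u..u + pi} (\<lambda>t. (1 / 2 - half_mass t)\<^sup>2 * sector_density t)"
  have "triangle_prob (polar_region r)
      = - (half_mass u)\<^sup>2 * (3 - 2 * half_mass u) + 6 * (half_mass u / 4 - V)"
    using triangle_prob_half_turn[of u] integral_half_mass_complement[of u "u + pi"]
    by (simp add: V_def flip: half_mass_def)
  then show ?thesis
    unfolding V_def[symmetric] by (simp add: field_simps power2_eq_square power3_eq_cube)
qed

lemma triangle_prob_full_turn:
  "triangle_prob (polar_region r) = - 1 / 2
    + 3 * integral {u..u + 2 * pi} (\<lambda>t. half_mass t * (1 - half_mass t) * sector_density t)"
  using triangle_prob_eq_integral[of u] integral_half_mass_square_period[of u] by simp

lemma triangle_prob_full_turn_square:
  "triangle_prob (polar_region r) = 1 / 4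
    - 3 * integral {u..u + 2 * pi} (\<lambda>t. (1 / 2 - half_mass t)\<^sup>2 * sector_density t)"
  using triangle_prob_full_turn[of u] integral_half_mass_complement[of u "u + 2 * pi"]
    integral_period[of u]
  by simp

end

theorem theorem1p1:
  fixes r :: "real \<Rightarrow> real"
  assumes pos: "\<And>\<theta>. r \<theta> > 0"
    and cont: "continuous_on UNIV r"
    and periodic: "\<And>\<theta>. r (\<theta> + 2 * pi) = r \<theta>"
    and pwd: "r piecewise_differentiable_on {0..2 * pi}"
    and area: "measure lborel (polar_region r) = 1"
  shows
    "(\<forall>\<theta>u. let x = arc_int r \<theta>u (\<theta>u + pi) (\<lambda>_. 1) in
        triangle_prob (polar_region r) =
          - x\<^sup>2 * (3 - 2 * x)
          + 6 * arc_int r \<theta>u (\<theta>u + pi) (\<lambda>t. Hfun r t * (1 - Hfun r t))) \<and>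
     (\<forall>\<theta>u. let x = arc_int r \<theta>u (\<theta>u + pi) (\<lambda>_. 1) in
        triangle_prob (polar_region r) =
          1 / 4 - (1 - 2 * x) ^ 3 / 4
          - 6 * arc_int r \<theta>u (\<theta>u + pi) (\<lambda>t. (1 / 2 - Hfun r t)\<^sup>2)) \<and>
     (\<exists>\<theta>u. triangle_prob (polar_region r) =
          1 / 4 - 6 * arc_int r \<theta>u (\<theta>u + pi) (\<lambda>t. (1 / 2 - Hfun r t)\<^sup>2)) \<and>
     triangle_prob (polar_region r) =
          - 1 / 2 + 3 * arc_int r 0 (2 * pi) (\<lambda>t. Hfun r t * (1 - Hfun r t)) \<and>
     triangle_prob (polar_region r) =
          1 / 4 - 3 * arc_int r 0 (2 * pi) (\<lambda>t. (1 / 2 - Hfun r t)\<^sup>2)"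
proof -
  interpret unit_polar_curve r
    using pos cont periodic area by unfold_locales
  obtain u where "half_mass u = 1 / 2"
    using ex_half_mass_eq_half by blast
  then have "\<exists>u. triangle_prob (polar_region r)
      = 1 / 4 - 6 * integral {u..u + pi} (\<lambda>t. (1 / 2 - half_mass t)\<^sup>2 * sector_density t)"
    using triangle_prob_half_turn_square[of u] by (intro exI[of _ u]) simp
  then show ?thesis
    unfolding Let_def Hfun_def[symmetric] unfolding Hfun_eq_half_mass arc_int_eq
    using triangle_prob_half_turn triangle_prob_half_turn_square
      triangle_prob_full_turn[of 0, unfolded add_0] triangle_prob_full_turn_square[of 0, unfolded add_0]
    by blast
qed

end
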